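(* Let $n\ge1$, $k\ge1$, $g\ge1$ be fixed integers. The maximum number of success runs (of order $k$ with gap $g$), over all sequences of $n$ success/failure trials, is $\lfloor (n+g)/(k+g)\rfloor$.
   Context: Consider a sequence of $n$ trials, each $S$ (success) or $F$ (failure). The success runs (of order $k$ with gap $g$) are defined inductively. The first success run (if it exists) is the first run of at least $k$ consecutive successes, taken maximal (it cannot be extended to a longer run). A success run terminates at trial $m$ if trial $m$ is its last success, i.e. either $m=n$ or trial $m+1$ is a failure. If the $j$-th success run terminates at trial $m$, then the $(j+1)$-th success run (if it exists) is the first run of at least $k$ consecutive successes which begins later than trial $m+g$, taken maximal among runs beginning later than trial $m+g$. *)

theory Defs
  imports Complex_Main
begin

text \<open>
  A sequence of trials is a \<open>bool list\<close> (\<open>True\<close> is a success). Trials are numbered from 1,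
  so trial \<open>i\<close> is \<open>xs ! (i - 1)\<close>. A run is given by its first trial \<open>a\<close> and its last trial \<open>m\<close>.
\<close>

definition consecutive_successes :: "bool list \<Rightarrow> nat \<Rightarrow> nat \<Rightarrow> bool" where
  "consecutive_successes xs a m \<longleftrightarrow>
     1 \<le> a \<and> a \<le> m \<and> m \<le> length xs \<and> (\<forall>i\<in>{a..m}. xs ! (i - 1))"

text \<open>
  Maximality is only among runs that begin later than trial \<open>b\<close>: a run starting at trial
  \<open>b + 1\<close> counts as maximal on the left even if trial \<open>b\<close> is a success.
\<close>

definition maximal_run_after :: "nat \<Rightarrow> bool list \<Rightarrow> nat \<Rightarrow> nat \<Rightarrow> nat \<Rightarrow> bool" where
  "maximal_run_after k xs b a m \<longleftrightarrow>
     b < a \<and> consecutive_successes xs a m \<and> k \<le> card {a..m} \<and>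
     (\<forall>a' m'. b < a' \<and> consecutive_successes xs a' m' \<and> {a..m} \<subseteq> {a'..m'}
        \<longrightarrow> a' = a \<and> m' = m)"

definition first_run_after :: "nat \<Rightarrow> bool list \<Rightarrow> nat \<Rightarrow> nat \<Rightarrow> nat \<Rightarrow> bool" where
  "first_run_after k xs b a m \<longleftrightarrow>
     maximal_run_after k xs b a m \<and> (\<forall>a' m'. maximal_run_after k xs b a' m' \<longrightarrow> a \<le> a')"

text \<open>
  \<open>success_run k g xs j a m\<close>: the \<open>j\<close>-th success run of order \<open>k\<close> with gap \<open>g\<close> exists, begins
  at trial \<open>a\<close> and terminates at trial \<open>m\<close>. Beginning later than trial 0 is no restriction.
\<close>

inductive success_run :: "nat \<Rightarrow> nat \<Rightarrow> bool list \<Rightarrow> nat \<Rightarrow> nat \<Rightarrow> nat \<Rightarrow> bool"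
  for k g :: nat and xs :: "bool list" where
  first: "first_run_after k xs 0 a m \<Longrightarrow> success_run k g xs 1 a m"
| later: "success_run k g xs j a m \<Longrightarrow> first_run_after k xs (m + g) a' m' \<Longrightarrow>
    success_run k g xs (Suc j) a' m'"

definition num_success_runs :: "nat \<Rightarrow> nat \<Rightarrow> bool list \<Rightarrow> nat" where
  "num_success_runs k g xs = card {(a, m). \<exists>j. success_run k g xs j a m}"

end

theory Submission
  imports Defs
begin

text \<open>
  Each success run has at least \<open>k\<close> trials and the next one begins more than \<open>g\<close> trials after
  its end, so the \<open>j\<close>-th run terminates no earlier than trial \<open>j * (k + g) - g\<close>. For the sequence
  that alternates \<open>k\<close> successes and \<open>g\<close> failures, it terminates exactly there.
\<close>

text \<open>Both runs begin at the same trial, so their intervals are nested, and maximality of the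
  smaller one forces equality.\<close>

lemma first_run_after_unique:
  assumes "first_run_after k xs b a m" and "first_run_after k xs b a' m'"
  shows "a = a' \<and> m = m'"
proof -
  have max: "maximal_run_after k xs b a m" "maximal_run_after k xs b a' m'"
    and a: "a = a'"
    using assms by (auto simp: first_run_after_def intro: antisym)
  have "{a..m} \<subseteq> {a'..m'} \<or> {a'..m'} \<subseteq> {a..m}"
    using a by auto
  then show ?thesis
  proof
    assume "{a..m} \<subseteq> {a'..m'}"
    with max show ?thesis
      unfolding maximal_run_after_def by blast
  next
    assume "{a'..m'} \<subseteq> {a..m}"
    with max show ?thesis
      unfolding maximal_run_after_def by blast
  qed
qed

lemma first_run_after_bounds:
  assumes "first_run_after k xs b a m"
  shows "b + k \<le> m" and "m \<le> length xs"
proof -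
  from assms have "b < a" "consecutive_successes xs a m" "k \<le> card {a..m}"
    by (simp_all only: first_run_after_def maximal_run_after_def)
  then show "b + k \<le> m" and "m \<le> length xs"
    by (auto simp: consecutive_successes_def)
qed

text \<open>This turns counting runs into counting indices: each index contributes at most one
  pair.\<close>

lemma success_run_unique:
  assumes "success_run k g xs j a m" and "success_run k g xs j a' m'"
  shows "a = a' \<and> m = m'"
  using assms
proof (induction arbitrary: a' m' rule: success_run.induct)
  case (first a m)
  from first.prems have "first_run_after k xs 0 a' m'"
    by cases (auto elim: success_run.cases)
  with first.hyps show ?case
    by (rule first_run_after_unique)
next
  case (later j a m c p)
  \<comment> \<open>Excludes the rule \<open>first\<close> when the run with index
    \<open>Suc j\<close> is inverted, since that rule would require
    \<open>Suc j = 1\<close>.\<close>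
  have "j \<noteq> 0"
    using later.hyps(1) by cases auto
  with later.prems obtain a0 m0 where
    "success_run k g xs j a0 m0" "first_run_after k xs (m0 + g) a' m'"
    by cases auto
  with later.IH later.hyps(2) show ?case
    by (metis first_run_after_unique)
qed

text \<open>Adding \<open>g\<close> to the end makes the induction uniform and avoids truncated
  subtraction: the first run gives at least \<open>k + g\<close>, and each later run adds at least
  \<open>k + g\<close>.\<close>

lemma success_run_end_ge:
  assumes "success_run k g xs j a m"
  shows "j * (k + g) \<le> m + g"
  using assms
proof induction
  case (first a m)
  then show ?case
    using first_run_after_bounds(1)[OF first.hyps] by simp
next
  case (later j a m a' m')
  then show ?case
    using first_run_after_bounds(1)[OF later.hyps(2)] by simp
qed

lemma success_run_index_le:
  assumes "success_run k g xs j a m" and "k \<ge> 1"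
  shows "j \<le> (length xs + g) div (k + g)"
proof -
  from assms(1) have "m \<le> length xs"
    by cases (simp_all add: first_run_after_bounds(2))
  with success_run_end_ge[OF assms(1)] have "j * (k + g) \<le> length xs + g"
    by linarith
  with assms(2) show ?thesis
    by (simp add: less_eq_div_iff_mult_less_eq)
qed

lemma success_run_index_pos: "success_run k g xs j a m \<Longrightarrow> 1 \<le> j"
  by (induction rule: success_run.induct) auto

text \<open>The indices from 1 to the bound enumerate all runs. Finiteness is stated separately
  because the lower bound needs it: \<open>card\<close> of an infinite set is 0.\<close>

lemma
  assumes "k \<ge> 1"
  shows finite_success_runs: "finite {(a, m). \<exists>j. success_run k g xs j a m}"
    and num_success_runs_le: "num_success_runs k g xs \<le> (length xs + g) div (k + g)"
proof -
  let ?R = "{(a, m). \<exists>j. success_run k g xs j a m}"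
  let ?N = "(length xs + g) div (k + g)"
  \<comment> \<open>\<open>f j\<close> is unspecified if there is no \<open>j\<close>-th run; this
    is harmless, as only an inclusion into the image of \<open>f\<close> is claimed.\<close>
  define f where "f j = (THE r. success_run k g xs j (fst r) (snd r))" for j
  have sub: "?R \<subseteq> f ` {1..?N}"
  proof clarify
    fix a m j
    assume run: "success_run k g xs j a m"
    have "f j = (a, m)"
      unfolding f_def
    proof (rule the_equality)
      fix r assume "success_run k g xs j (fst r) (snd r)"
      from success_run_unique[OF run this] show "r = (a, m)"
        by (simp add: prod_eq_iff)
    qed (simp add: run)
    moreover have "j \<in> {1..?N}"
      using success_run_index_le[OF run assms] success_run_index_pos[OF run] by simp
    ultimately show "(a, m) \<in> f ` {1..?N}"
      by (metis imageI)
  qed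
  then show "finite ?R"
    by (rule finite_subset) simp
  have "card ?R \<le> card {1..?N}"
    by (rule surj_card_le[OF _ sub]) simp
  then show "num_success_runs k g xs \<le> ?N"
    by (simp add: num_success_runs_def)
qed

definition periodic_trials :: "nat \<Rightarrow> nat \<Rightarrow> nat \<Rightarrow> bool list" where
  "periodic_trials k g n = map (\<lambda>i. i mod (k + g) < k) [0..<n]"

text \<open>The search starts exactly at a block boundary, so the run is the block's
  \<open>k\<close> successes. On the left it is cut off by the search bound, on the right by a
  failure or by the end of the sequence.\<close>

lemma periodic_trials_first_run:
  assumes "k \<ge> 1" and "g \<ge> 1" and "j * (k + g) + k \<le> n"
  shows "first_run_after k (periodic_trials k g n) (j * (k + g))
    (Suc (j * (k + g))) (j * (k + g) + k)"
proof -
  let ?xs = "periodic_trials k g n"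
  let ?b = "j * (k + g)"
  have nth: "?xs ! (?b + i) \<longleftrightarrow> i < k" if "?b + i < n" "i < k + g" for i
  proof -
    have "(?b + i) mod (k + g) = i"
      using that(2) by (metis mod_less mod_mult_self3)
    with that(1) show ?thesis
      unfolding periodic_trials_def by (subst nth_map) simp_all
  qed
  have run: "consecutive_successes ?xs (Suc ?b) (?b + k)"
    unfolding consecutive_successes_def
  proof (intro conjI ballI)
    fix i assume i: "i \<in> {Suc ?b..?b + k}"
    then have "i = Suc (?b + (i - Suc ?b))"
      by simp
    then obtain r where "i = Suc (?b + r)" ..
    with i nth[of r] assms(3) show "?xs ! (i - 1)" by simp
  qed (use assms in \<open>auto simp: periodic_trials_def\<close>)
  have "a' = Suc ?b \<and> m' = ?b + k"
    if "?b < a'" "consecutive_successes ?xs a' m'" "{Suc ?b..?b + k} \<subseteq> {a'..m'}" for a' m'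
  proof -
    have a': "a' = Suc ?b" and m': "?b + k \<le> m'"
      using that(1,3) assms(1) by auto
    have "\<not> ?b + k < m'"
    proof
      assume less: "?b + k < m'"
      with a' have "Suc (?b + k) \<in> {a'..m'}"
        by simp
      with that(2) have "?xs ! (Suc (?b + k) - 1)" "m' \<le> length ?xs"
        unfolding consecutive_successes_def by blast+
      then have "?xs ! (?b + k)" "m' \<le> n"
        by (simp_all add: periodic_trials_def)
      \<comment> \<open>List index \<open>?b + k\<close> is trial \<open>?b + k + 1\<close>, the
        first failure of the block; it exists in the block because \<open>g\<close> is
        positive.\<close>
      with less nth[of k] assms(2) show False by simp
    qed
    with a' m' show ?thesis by simp
  qed
  moreover have "?b < Suc ?b" "k \<le> card {Suc ?b..?b + k}"
    by simp_all
  ultimately have "maximal_run_after k ?xs ?b (Suc ?b) (?b + k)"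
    using run unfolding maximal_run_after_def by blast
  moreover have "Suc ?b \<le> a'" if "maximal_run_after k ?xs ?b a' m'" for a' m'
    using that unfolding maximal_run_after_def by (simp only: Suc_le_eq)
  ultimately show ?thesis
    unfolding first_run_after_def by blast
qed

text \<open>The end of a run plus the gap \<open>g\<close> is the boundary of the next block, so no
  trial is wasted.\<close>

lemma periodic_trials_success_run:
  assumes "k \<ge> 1" and "g \<ge> 1" and "j * (k + g) + k \<le> n"
  shows "success_run k g (periodic_trials k g n) (Suc j)
    (Suc (j * (k + g))) (j * (k + g) + k)"
  using assms(3)
proof (induction j)
  case 0
  then show ?case
    using success_run.first periodic_trials_first_run[OF assms(1,2), of 0 n] by simp
next
  case (Suc j)
  have "Suc j * (k + g) = j * (k + g) + k + g"
    by simp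
  then show ?case
    using Suc success_run.later periodic_trials_first_run[OF assms(1,2) Suc.prems]
    by (metis add_leD1)
qed

lemma num_success_runs_periodic_ge:
  assumes "k \<ge> 1" and "g \<ge> 1"
  shows "(n + g) div (k + g) \<le> num_success_runs k g (periodic_trials k g n)"
proof -
  let ?N = "(n + g) div (k + g)"
  let ?h = "\<lambda>j. (Suc (j * (k + g)), j * (k + g) + k)"
  \<comment> \<open>The last block needs only its \<open>k\<close> successes; the \<open>g\<close>
    in \<open>n + g\<close> makes up for its missing failures.\<close>
  have "j * (k + g) + k \<le> n" if "j < ?N" for j
  proof -
    have "Suc j * (k + g) \<le> n + g"
      using that assms(1) less_eq_div_iff_mult_less_eq[of "k + g" "Suc j"]
      by (simp only: Suc_le_eq add_pos_nonneg)
    then show ?thesis by simp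
  qed
  then have "?h ` {..<?N} \<subseteq> {(a, m). \<exists>j. success_run k g (periodic_trials k g n) j a m}"
    using periodic_trials_success_run[OF assms] by blast
  moreover have "inj_on ?h {..<?N}"
    using assms by (auto simp: inj_on_def)
  ultimately have "card {..<?N} \<le> num_success_runs k g (periodic_trials k g n)"
    unfolding num_success_runs_def
    using finite_success_runs[OF assms(1)] by (intro card_inj_on_le)
  then show ?thesis by simp
qed

theorem proposition1p1:
  fixes n k g :: nat
  assumes "n \<ge> 1" and "k \<ge> 1" and "g \<ge> 1"
  shows "int (Max {num_success_runs k g xs | xs. length xs = n}) =
    \<lfloor>real (n + g) / real (k + g)\<rfloor>"
proof -
  let ?V = "{num_success_runs k g xs | xs. length xs = n}"
  let ?N = "(n + g) div (k + g)"
  have le: "v \<le> ?N" if "v \<in> ?V" for v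
    using that num_success_runs_le[OF assms(2)] by blast
  have len: "length (periodic_trials k g n) = n"
    by (simp add: periodic_trials_def)
  then have "num_success_runs k g (periodic_trials k g n) = ?N"
    using num_success_runs_le[OF assms(2), of g "periodic_trials k g n"]
      num_success_runs_periodic_ge[OF assms(2,3), of n] by simp
  with len have "?N \<in> ?V"
    by (metis (mono_tags, lifting) mem_Collect_eq)
  moreover have "finite ?V"
    using le by (meson finite_nat_set_iff_bounded_le)
  ultimately have "Max ?V = ?N"
    using le by (intro Max_eqI)
  then show ?thesis
    by (simp add: floor_divide_of_nat_eq del: of_nat_add)
qed

end
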